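(* If a perfect Euler cuboid exists, i.e. if there exist positive integers $x_1,x_2,x_3,d_1,d_2,d_3,L$ with $x_1^2+x_2^2+x_3^2=L^2$, $x_2^2+x_3^2=d_1^2$, $x_3^2+x_1^2=d_2^2$, $x_1^2+x_2^2=d_3^2$, then the equation $$4E_{11}^2+E_{10}^4+E_{01}^4-2E_{10}^2E_{01}^2-2L^2E_{10}^2-6E_{01}^2L^2+L^4=0$$ has a solution in positive rational numbers $E_{10},E_{01},E_{11},L$. *)

theory Defs imports Complex_Main begin

end

theory Submission imports Defs begin

text \<open>
  Put \<open>z\<^sub>j = x\<^sub>j + i d\<^sub>j\<close>. Pythagoras turns the cuboid conditions into \<open>\<bar>z\<^sub>j\<bar> = L\<close>, so the
  elementary symmetric polynomials satisfy \<open>\<bar>e\<^sub>2(z)\<bar> = L \<bar>e\<^sub>1(z)\<bar>\<close>. The real and imaginary parts of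
  \<open>e\<^sub>1\<close> are \<open>E10\<close> and \<open>E01\<close>, the imaginary part of \<open>e\<^sub>2\<close> is \<open>E11\<close>, and its real part is
  \<open>(E10\<^sup>2 - E01\<^sup>2 + L\<^sup>2) / 2\<close>, because the \<open>x\<^sub>j\<^sup>2\<close> sum to \<open>L\<^sup>2\<close> and the \<open>d\<^sub>j\<^sup>2\<close> sum to \<open>2 L\<^sup>2\<close>.
\<close>

text \<open>For nonzero complex \<open>z\<^sub>j\<close> on the circle of radius \<open>L\<close>,
  the conjugate of \<open>z\<^sub>j\<close> is \<open>L\<^sup>2 / z\<^sub>j\<close>, so
  \<open>e\<^sub>2\<close> is \<open>e\<^sub>3 / L\<^sup>2\<close> times the conjugate of
  \<open>e\<^sub>1\<close>. The proof avoids this division.\<close>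

lemma norm_elementary_symmetric_2_circle:
  fixes x1 x2 x3 d1 d2 d3 L :: "'a :: idom"
  assumes "x1^2 + d1^2 = L^2" "x2^2 + d2^2 = L^2" "x3^2 + d3^2 = L^2"
  shows "(x1*x2 + x2*x3 + x3*x1 - (d1*d2 + d2*d3 + d3*d1))^2
       + (x1*d2 + d1*x2 + x2*d3 + d2*x3 + x3*d1 + d3*x1)^2
       = L^2 * ((x1 + x2 + x3)^2 + (d1 + d2 + d3)^2)"
proof -
  \<comment> \<open>The cross term of \<open>z\<^sub>1 z\<^sub>2\<close> and
    \<open>z\<^sub>2 z\<^sub>3\<close> carries the squared modulus of their common factor
    \<open>z\<^sub>2\<close>; likewise for the other pairs.\<close>
  have "(x1*x2 + x2*x3 + x3*x1 - (d1*d2 + d2*d3 + d3*d1))^2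
       + (x1*d2 + d1*x2 + x2*d3 + d2*x3 + x3*d1 + d3*x1)^2
    = (x1^2 + d1^2) * (x2^2 + d2^2) + (x2^2 + d2^2) * (x3^2 + d3^2)
       + (x3^2 + d3^2) * (x1^2 + d1^2)
       + 2 * ((x1^2 + d1^2) * (x2*x3 + d2*d3) + (x2^2 + d2^2) * (x3*x1 + d3*d1)
            + (x3^2 + d3^2) * (x1*x2 + d1*d2))"
    by algebra
  also have "\<dots> = L^2 * ((x1^2 + d1^2) + (x2^2 + d2^2) + (x3^2 + d3^2)
       + 2 * ((x2*x3 + d2*d3) + (x3*x1 + d3*d1) + (x1*x2 + d1*d2)))"
    unfolding assms by algebra
  also have "\<dots> = L^2 * ((x1 + x2 + x3)^2 + (d1 + d2 + d3)^2)"
    by algebra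
  finally show ?thesis .
qed

lemma cuboid_equation:
  fixes x1 x2 x3 d1 d2 d3 L :: "'a :: idom"
  assumes "x1^2 + x2^2 + x3^2 = L^2"
    and "x2^2 + x3^2 = d1^2" "x3^2 + x1^2 = d2^2" "x1^2 + x2^2 = d3^2"
  defines "E10 \<equiv> x1 + x2 + x3" and "E01 \<equiv> d1 + d2 + d3"
    and "E11 \<equiv> x1*d2 + d1*x2 + x2*d3 + d2*x3 + x3*d1 + d3*x1"
  shows "4 * E11^2 + E10^4 + E01^4 - 2 * E10^2 * E01^2 - 2 * L^2 * E10^2
        - 6 * E01^2 * L^2 + L^4 = 0"
proof -
  define R where "R = x1*x2 + x2*x3 + x3*x1 - (d1*d2 + d2*d3 + d3*d1)"
  have "x1^2 + d1^2 = L^2" "x2^2 + d2^2 = L^2" "x3^2 + d3^2 = L^2"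
    by (simp_all add: algebra_simps flip: assms(1-4))
  then have norm: "R^2 + E11^2 = L^2 * (E10^2 + E01^2)"
    unfolding R_def E10_def E01_def E11_def by (rule norm_elementary_symmetric_2_circle)
  have "E10^2 - E01^2 = (x1^2 + x2^2 + x3^2) - (d1^2 + d2^2 + d3^2) + 2 * R"
    unfolding R_def E10_def E01_def by algebra
  moreover have "d1^2 + d2^2 + d3^2 = 2 * L^2"
    by (simp add: algebra_simps flip: assms(1-4))
  ultimately have R: "2 * R = E10^2 - E01^2 + L^2"
    using assms(1) by simp
  \<comment> \<open>The factor 4 lets \<open>R\<close> enter only as \<open>2 * R\<close>, so
    nothing is divided by 2.\<close>
  have "4 * E11^2 = 4 * (L^2 * (E10^2 + E01^2)) - (2 * R)^2"
    unfolding norm[symmetric] by algebra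
  then show ?thesis
    unfolding R by algebra
qed

theorem theorem6p1:
  assumes "\<exists>x1 x2 x3 d1 d2 d3 L :: int.
      x1 > 0 \<and> x2 > 0 \<and> x3 > 0 \<and> d1 > 0 \<and> d2 > 0 \<and> d3 > 0 \<and> L > 0 \<and>
      x1^2 + x2^2 + x3^2 = L^2 \<and>
      x2^2 + x3^2 = d1^2 \<and> x3^2 + x1^2 = d2^2 \<and> x1^2 + x2^2 = d3^2"
  shows "\<exists>E10 E01 E11 L :: rat.
      E10 > 0 \<and> E01 > 0 \<and> E11 > 0 \<and> L > 0 \<and>
      4 * E11^2 + E10^4 + E01^4 - 2 * E10^2 * E01^2 - 2 * L^2 * E10^2
        - 6 * E01^2 * L^2 + L^4 = 0"
proof -
  from assms obtain x1 x2 x3 d1 d2 d3 L :: int where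
    eqs: "x1^2 + x2^2 + x3^2 = L^2"
      "x2^2 + x3^2 = d1^2" "x3^2 + x1^2 = d2^2" "x1^2 + x2^2 = d3^2" and
    pos: "x1 > 0" "x2 > 0" "x3 > 0" "d1 > 0" "d2 > 0" "d3 > 0" "L > 0"
    by (elim exE conjE) (rule that)
  define E10 where "E10 = x1 + x2 + x3"
  define E01 where "E01 = d1 + d2 + d3"
  define E11 where "E11 = x1*d2 + d1*x2 + x2*d3 + d2*x3 + x3*d1 + d3*x1"
  have "4 * E11^2 + E10^4 + E01^4 - 2 * E10^2 * E01^2 - 2 * L^2 * E10^2
        - 6 * E01^2 * L^2 + L^4 = 0"
    unfolding E10_def E01_def E11_def using eqs by (rule cuboid_equation)
  \<comment> \<open>The witnesses are integers; the ring homomorphism \<open>of_int\<close> carries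
    the equation to \<open>rat\<close>.\<close>
  from arg_cong[OF this, of "of_int :: int \<Rightarrow> rat"]
  have "4 * (of_int E11)^2 + (of_int E10)^4 + (of_int E01)^4 - 2 * (of_int E10)^2 * (of_int E01)^2
        - 2 * (of_int L)^2 * (of_int E10)^2 - 6 * (of_int E01)^2 * (of_int L)^2 + (of_int L)^4
      = (0 :: rat)"
    by (simp only: of_int_add of_int_diff of_int_mult of_int_power of_int_numeral of_int_0)
  moreover have "E10 > 0" "E01 > 0" "E11 > 0"
    using pos by (simp_all add: E10_def E01_def E11_def add_pos_pos)
  ultimately show ?thesis
    using \<open>L > 0\<close>
    by (intro exI[of _ "of_int E10"] exI[of _ "of_int E01"] exI[of _ "of_int E11"]
        exI[of _ "of_int L"] conjI) (simp_all only: of_int_0_less_iff)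
qed

end
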